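(* For every integer $k\ge 1$, the critical value of the one-dimensional $\mathrm{GN}_k(1,\alpha)$ model satisfies $\alpha_c^{(k)}(1)=\infty$.
   Context: Let $X$ be a homogeneous Poisson process on $\mathbb{R}^d$ (of some positive, finite density; the choice of density only rescales the model). For $x\in X$ let $d_i(x)$ be the Euclidean distance from $x$ to its $i$th nearest neighbour among the other points of $X$. For an integer $k\ge 1$ and a real $\alpha\ge 0$, the model $\mathrm{GN}_k(d,\alpha)$ is the random undirected graph with vertex set $X$ in which each $x\in X$ is joined by an edge to every $y\in X$ with $y \neq x$ and $|x-y|\le r(x)$, where $r(x)=\alpha d_k(x)$ (so $x,y$ are adjacent iff $|x-y|\le r(x)$ or $|x-y|\le r(y)$). Let $U$ be the event that the graph has an infinite connected component. The critical value is $\alpha_c^{(k)}(d)=\inf\{\alpha\ge 0:\mathbb{P}(U)>0\}$ (with $\inf\emptyset=\infty$), where $\mathbb{P}(U)$ is computed in $\mathrm{GN}_k(d,\alpha)$. *)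

theory Defs
  imports "HOL-Probability.Probability"
begin

text \<open>
  A homogeneous Poisson process of intensity \<open>\<rho>\<close> on a Euclidean space, as a random locally finite
  set of points. The counting variables are only constrained on bounded Borel sets, where local
  finiteness ensures that \<^const>\<open>card\<close> really counts points. The null-set case
  \<open>measure lborel B = 0\<close> is covered by the convention \<open>0 ^ 0 = 1\<close>.
\<close>

locale homogeneous_poisson_process = prob_space M
  for M :: "'w measure" +
  fixes X :: "'w \<Rightarrow> 'a::euclidean_space set" and \<rho> :: real
  assumes intensity_pos: "0 < \<rho>"
    and locally_finite: "\<lbrakk>\<omega> \<in> space M; bounded B\<rbrakk> \<Longrightarrow> finite (X \<omega> \<inter> B)"
    and count_measurable: "\<lbrakk>B \<in> sets borel; bounded B\<rbrakk> \<Longrightarrow>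
          (\<lambda>\<omega>. card (X \<omega> \<inter> B)) \<in> measurable M (count_space UNIV)"
    and count_distribution: "\<lbrakk>B \<in> sets borel; bounded B\<rbrakk> \<Longrightarrow>
          prob {\<omega> \<in> space M. card (X \<omega> \<inter> B) = n} =
            (\<rho> * measure lborel B) ^ n / fact n * exp (- (\<rho> * measure lborel B))"
    and count_indep: "\<lbrakk>finite I; \<And>i. i \<in> I \<Longrightarrow> C i \<in> sets borel \<and> bounded (C i);
            disjoint_family_on C I\<rbrakk> \<Longrightarrow>
          indep_vars (\<lambda>_. count_space UNIV) (\<lambda>(i::nat) \<omega>. card (X \<omega> \<inter> C i)) I"

text \<open>
  The distance from \<open>x\<close> to its \<open>i\<close>th nearest neighbour among the points of \<open>V\<close> other than \<open>x\<close>: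
  the least radius \<open>r\<close> for which at least \<open>i\<close> of these points lie within distance \<open>r\<close>. It is
  meaningful for locally finite \<open>V\<close> with at least \<open>i\<close> points besides \<open>x\<close>; a Poisson process on
  the whole space is almost surely infinite.
\<close>

definition nn_dist :: "'a::euclidean_space set \<Rightarrow> nat \<Rightarrow> 'a \<Rightarrow> real" where
  "nn_dist V i x = Inf {r. 0 \<le> r \<and> i \<le> card {y \<in> V - {x}. dist x y \<le> r}}"

definition gn_radius :: "'a::euclidean_space set \<Rightarrow> nat \<Rightarrow> real \<Rightarrow> 'a \<Rightarrow> real" where
  "gn_radius V k \<alpha> x = \<alpha> * nn_dist V k x"

definition gn_edges :: "'a::euclidean_space set \<Rightarrow> nat \<Rightarrow> real \<Rightarrow> ('a \<times> 'a) set" where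
  "gn_edges V k \<alpha> = {(x, y). x \<in> V \<and> y \<in> V \<and> x \<noteq> y \<and>
     (dist x y \<le> gn_radius V k \<alpha> x \<or> dist x y \<le> gn_radius V k \<alpha> y)}"

definition has_infinite_component :: "'v set \<Rightarrow> ('v \<times> 'v) set \<Rightarrow> bool" where
  "has_infinite_component V E \<longleftrightarrow> (\<exists>x\<in>V. infinite {y \<in> V. (x, y) \<in> E\<^sup>*})"

definition gn_percolation_event ::
    "'w measure \<Rightarrow> ('w \<Rightarrow> 'a::euclidean_space set) \<Rightarrow> nat \<Rightarrow> real \<Rightarrow> 'w set" where
  "gn_percolation_event M X k \<alpha> =
     {\<omega> \<in> space M. has_infinite_component (X \<omega>) (gn_edges (X \<omega>) k \<alpha>)}"

text \<open>
  The outer measure agrees with the probability on every measurable event. It is used because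
  \<^const>\<open>measure\<close> and \<^const>\<open>emeasure\<close> are \<open>0\<close> by convention on non-measurable sets, so that with
  them \<open>\<alpha>\<close> could drop out of the infimum merely for want of a measurability proof. The infimum is
  taken in \<^typ>\<open>ereal\<close>, where \<open>Inf {} = \<infinity>\<close>.
\<close>

definition gn_critical_value ::
    "'w measure \<Rightarrow> ('w \<Rightarrow> 'a::euclidean_space set) \<Rightarrow> nat \<Rightarrow> ereal" where
  "gn_critical_value M X k =
     Inf (ereal ` {\<alpha>. 0 \<le> \<alpha> \<and> 0 < outer_measure_of M (gn_percolation_event M X k \<alpha>)})"

end

theory Submission
  imports Defs
begin

text \<open>
  Cut the line at a point \<open>c\<close>. Partition it into a gap of radius \<open>g\<close> around \<open>c\<close> and cells on both sides
  whose lengths grow geometrically with ratio \<open>q\<close>, where \<open>\<alpha> * (q - 1) < 1\<close>. If the gap is empty and each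
  other cell has more than \<open>k\<close> points, then \<open>d\<^sub>k(x)\<close> is at most the length of the cell of \<open>x\<close>, so no
  ball reaches \<open>c\<close> and no edge crosses \<open>c\<close>. Choose centres so far apart that the windows formed by the
  first \<open>m\<close> cells on each side of the \<open>m\<close>th centre are disjoint. The windows are good independently and
  with probability bounded below, so almost surely infinitely many are good, and by Borel--Cantelli all
  cells outside the \<open>m\<close>th window are good for all large \<open>m\<close>. Hence almost surely there are uncrossed
  points arbitrarily far out in both directions, and components are finite by local finiteness.
\<close>

section \<open>Independence of events over disjoint blocks of variables\<close>

text \<open>Needed because \<open>count_indep\<close> speaks only of families indexed by natural
  numbers, while the cells below are indexed by pairs of a window and a cell number.\<close>

lemma (in prob_space) indep_vars_reindex_inj:
  assumes inj: "inj_on f I"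
    and ind: "indep_vars (\<lambda>_. N) X (f ` I)"
  shows "indep_vars (\<lambda>_. N) (\<lambda>i. X (f i)) I"
proof -
  let ?F = "\<lambda>i. {X i -` A \<inter> space M |A. A \<in> sets N}"
  have "indep_sets (\<lambda>i. ?F (f i)) I"
    unfolding indep_sets_def
  proof (intro conjI ballI allI impI)
    fix i assume "i \<in> I"
    then show "?F (f i) \<subseteq> events"
      using ind by (auto simp: indep_vars_def2 indep_sets_def)
  next
    fix J A assume J: "J \<subseteq> I" "J \<noteq> {}" "finite J" and A: "A \<in> (\<Pi> j\<in>J. ?F (f j))"
    have injJ: "inj_on f J"
      using inj J(1) by (rule inj_on_subset)
    let ?B = "\<lambda>n. A (inv_into J f n)"
    have B: "?B (f j) = A j" if "j \<in> J" for j
      using injJ that by simp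
    have "prob (\<Inter>n\<in>f ` J. ?B n) = (\<Prod>n\<in>f ` J. prob (?B n))"
    proof (rule indep_setsD)
      show "indep_sets ?F (f ` I)"
        using ind by (simp add: indep_vars_def2)
      show "\<forall>n\<in>f ` J. ?B n \<in> ?F n"
        using A B by (auto simp: Pi_iff)
    qed (use J in auto)
    then show "prob (\<Inter>j\<in>J. A j) = (\<Prod>j\<in>J. prob (A j))"
      using injJ by (simp add: prod.reindex B)
  qed
  then show ?thesis
    using ind by (auto simp: indep_vars_def2)
qed

text \<open>Restricting the family to disjoint blocks gives independent random elements of product
  spaces, so failures of different blocks are independent. Success of a block is a product event,
  whose probability factorises.\<close>

lemma (in prob_space) prob_all_blocks_fail:
  assumes ind: "indep_vars M' Y I"
    and L: "finite L" "L \<noteq> {}"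
    and K: "\<And>j. j \<in> L \<Longrightarrow> finite (K j) \<and> K j \<noteq> {} \<and> K j \<subseteq> I" "disjoint_family_on K L"
    and S: "\<And>i. i \<in> I \<Longrightarrow> S i \<in> sets (M' i)"
  shows "prob {\<omega> \<in> space M. \<forall>j\<in>L. \<exists>i\<in>K j. Y i \<omega> \<notin> S i} =
    (\<Prod>j\<in>L. 1 - (\<Prod>i\<in>K j. prob {\<omega> \<in> space M. Y i \<omega> \<in> S i}))"
proof -
  let ?P = "\<lambda>j. PiM (K j) M'"
  let ?R = "\<lambda>j \<omega>. restrict (\<lambda>i. Y i \<omega>) (K j)"
  let ?A = "\<lambda>j. space (?P j) - PiE (K j) S"
  have ind_R: "indep_vars ?P ?R L"
    by (rule indep_vars_restrict[OF ind]) (use K in auto)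
  have meas_Y: "Y i \<in> measurable M (M' i)" if "i \<in> I" for i
    using ind that by (auto simp: indep_vars_def2)
  have A: "?A j \<in> sets (?P j)" if "j \<in> L" for j
    using K(1)[OF that] S by (auto intro!: sets.Diff sets_PiM_I_finite)
  have vimage: "?R j -` ?A j \<inter> space M = {\<omega> \<in> space M. \<exists>i\<in>K j. Y i \<omega> \<notin> S i}" if "j \<in> L" for j
  proof -
    have "Y i \<omega> \<in> space (M' i)" if "i \<in> K j" "\<omega> \<in> space M" for i \<omega>
      using K(1)[OF \<open>j \<in> L\<close>] measurable_space[OF meas_Y] that by blast
    then have "?R j \<omega> \<in> ?A j \<longleftrightarrow> (\<exists>i\<in>K j. Y i \<omega> \<notin> S i)" if "\<omega> \<in> space M" for \<omega>
      using that by (simp add: space_PiM PiE_iff restrict_apply cong: ball_cong)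
    then show ?thesis by blast
  qed
  have block: "prob {\<omega> \<in> space M. \<exists>i\<in>K j. Y i \<omega> \<notin> S i} =
      1 - (\<Prod>i\<in>K j. prob {\<omega> \<in> space M. Y i \<omega> \<in> S i})" if j: "j \<in> L" for j
  proof -
    let ?G = "\<Inter>i\<in>K j. Y i -` S i \<inter> space M"
    have meas: "?G \<in> events"
    proof (rule sets.finite_INT)
      fix i assume "i \<in> K j"
      then have "i \<in> I" using K(1)[OF j] by blast
      then show "Y i -` S i \<inter> space M \<in> events"
        using measurable_sets[OF meas_Y S] by blast
    qed (use K(1)[OF j] in auto)
    have "prob ?G = (\<Prod>i\<in>K j. prob (Y i -` S i \<inter> space M))"
    proof (rule indep_varsD[OF ind])
      show "S i \<in> sets (M' i)" if "i \<in> K j" for i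
        using K(1)[OF j] S that by blast
    qed (use K(1)[OF j] in auto)
    moreover have "{\<omega> \<in> space M. \<exists>i\<in>K j. Y i \<omega> \<notin> S i} = space M - ?G"
      using K(1)[OF j] by auto
    ultimately show ?thesis
      using prob_compl[OF meas] by (simp add: vimage_def Int_def conj_commute)
  qed
  have "prob {\<omega> \<in> space M. \<forall>j\<in>L. \<exists>i\<in>K j. Y i \<omega> \<notin> S i} = prob (\<Inter>j\<in>L. ?R j -` ?A j \<inter> space M)"
    using L(2) by (intro arg_cong[where f = prob]) (auto simp: vimage)
  also have "\<dots> = (\<Prod>j\<in>L. prob (?R j -` ?A j \<inter> space M))"
    by (rule indep_varsD_finite[OF ind_R]) (use L A in auto)
  also have "\<dots> = (\<Prod>j\<in>L. 1 - (\<Prod>i\<in>K j. prob {\<omega> \<in> space M. Y i \<omega> \<in> S i}))"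
    by (intro prod.cong refl) (simp add: vimage block)
  finally show ?thesis .
qed

section \<open>Lower-tail bounds for Poisson counts\<close>

text \<open>A single term of the exponential series is at most its sum, as all terms are
  nonnegative.\<close>

lemma power_div_fact_mult_exp_le_1:
  fixes t :: real
  assumes "0 \<le> t"
  shows "t ^ n / fact n * exp (- t) \<le> 1"
proof -
  have "t ^ n / fact n \<le> exp t"
  proof -
    have "(\<Sum>i\<in>{n}. t ^ i /\<^sub>R fact i) \<le> exp t"
      unfolding exp_def using assms
      by (intro sum_le_suminf summable_exp_generic) auto
    then show ?thesis by (simp add: field_simps)
  qed
  then show ?thesis by (simp add: exp_minus field_simps)
qed

context homogeneous_poisson_process
begin

lemma count_indep_finite:
  fixes C :: "'i \<Rightarrow> 'a set"
  assumes "finite I" "\<And>i. i \<in> I \<Longrightarrow> C i \<in> sets borel \<and> bounded (C i)" "disjoint_family_on C I"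
  shows "indep_vars (\<lambda>_. count_space UNIV) (\<lambda>i \<omega>. card (X \<omega> \<inter> C i)) I"
proof -
  obtain f :: "'i \<Rightarrow> nat" where f: "inj_on f I"
    using finite_imp_inj_to_nat_seg[OF assms(1)] by blast
  let ?C = "\<lambda>n. C (inv_into I f n)"
  have "indep_vars (\<lambda>_. count_space UNIV) (\<lambda>n \<omega>. card (X \<omega> \<inter> ?C n)) (f ` I)"
  proof (rule count_indep)
    have "C i \<inter> C j = {}" if "i \<in> I" "j \<in> I" "f i \<noteq> f j" for i j
      using disjoint_family_onD[OF assms(3) that(1,2)] that(3) by blast
    then show "disjoint_family_on ?C (f ` I)"
      using f by (simp add: disjoint_family_on_def)
  qed (use assms f in auto)
  from indep_vars_reindex_inj[OF f this] show ?thesis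
    by (rule indep_vars_cong[THEN iffD1, rotated 3]) (use f in auto)
qed

lemma event_card_in:
  assumes "B \<in> sets borel" "bounded B"
  shows "{\<omega> \<in> space M. card (X \<omega> \<inter> B) \<in> S} \<in> events"
proof -
  have "(\<lambda>\<omega>. card (X \<omega> \<inter> B)) -` S \<inter> space M \<in> events"
    by (rule measurable_sets[OF count_measurable[OF assms]]) simp
  then show ?thesis by (simp add: vimage_def Int_def conj_commute)
qed

text \<open>Decay in the inverse volume is crude, but summable over cells of geometrically growing
  length.\<close>

lemma prob_count_le:
  assumes B: "B \<in> sets borel" "bounded B" and pos: "0 < measure lborel B"
  shows "prob {\<omega> \<in> space M. card (X \<omega> \<inter> B) \<le> k} \<le> (real k + 1)\<^sup>2 / (\<rho> * measure lborel B)"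
proof -
  define t where "t = \<rho> * measure lborel B"
  have t: "0 < t"
    using intensity_pos pos by (simp add: t_def)
  let ?E = "\<lambda>n. {\<omega> \<in> space M. card (X \<omega> \<inter> B) = n}"
  have "?E n \<in> events" for n
    using event_card_in[OF B, of "{n}"] by simp
  then have "prob (\<Union>n\<in>{..k}. ?E n) \<le> (\<Sum>n\<in>{..k}. prob (?E n))"
    by (intro finite_measure_subadditive_finite) auto
  also have "\<dots> \<le> (\<Sum>n\<in>{..k}. (real k + 1) / t)"
  proof (rule sum_mono)
    fix n assume n: "n \<in> {..k}"
    have "prob (?E n) = t ^ n / fact n * exp (- t)"
      using count_distribution[OF B] by (simp add: t_def)
    \<comment> \<open>Shifting \<open>n\<close> to \<open>n + 1\<close> pulls out a factor
      \<open>1 / t\<close>; what remains is again a Poisson weight, hence at most 1.\<close>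
    also have "\<dots> = (real n + 1) / t * (t ^ Suc n / fact (Suc n) * exp (- t))"
    proof -
      have "t ^ Suc n / fact (Suc n) = t / (real n + 1) * (t ^ n / fact n)"
        by (simp add: add.commute)
      then show ?thesis using t by (simp del: power_Suc fact_Suc)
    qed
    also have "\<dots> \<le> (real n + 1) / t * 1"
      using t by (intro mult_left_mono power_div_fact_mult_exp_le_1) auto
    also have "\<dots> \<le> (real k + 1) / t"
      using t n by (simp add: divide_right_mono)
    finally show "prob (?E n) \<le> (real k + 1) / t" .
  qed
  also have "\<dots> = (real k + 1)\<^sup>2 / t"
    by (simp add: power2_eq_square)
  also have "(\<Union>n\<in>{..k}. ?E n) = {\<omega> \<in> space M. card (X \<omega> \<inter> B) \<le> k}"
    by auto
  finally show ?thesis by (simp add: t_def)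
qed

end

section \<open>Nearest-neighbour distances and the geometric partition\<close>

lemma nn_dist_le:
  assumes "i \<le> card {y \<in> V - {x}. dist x y \<le> r}" "0 \<le> r"
  shows "nn_dist V i x \<le> r"
  unfolding nn_dist_def using assms by (intro cInf_lower) (auto intro!: bdd_belowI[of _ 0])

text \<open>
  The breakpoints \<open>\<dots>, - g * q, - g, g, g * q, \<dots>\<close> of a partition of the line, indexed so that
  the cell number 0 is the central gap.
\<close>

definition breakpoint :: "real \<Rightarrow> real \<Rightarrow> int \<Rightarrow> real" where
  "breakpoint g q i = (if 1 \<le> i then g * q ^ nat (i - 1) else - (g * q ^ nat (- i)))"

text \<open>Half-open, so that consecutive cells share no endpoint and together tile the
  line.\<close>

definition cell :: "real \<Rightarrow> real \<Rightarrow> real \<Rightarrow> int \<Rightarrow> real set" where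
  "cell g q c i = {c + breakpoint g q i ..< c + breakpoint g q (i + 1)}"

text \<open>The good counts. The bound \<open>k\<close> is strict because a point is not its own
  neighbour: \<open>k\<close> others must remain in its cell.\<close>

definition cell_counts :: "nat \<Rightarrow> int \<Rightarrow> nat set" where
  "cell_counts k i = (if i = 0 then {0} else {k<..})"

lemma breakpoint_right: "breakpoint g q (int j + 1) = g * q ^ j"
  by (simp add: breakpoint_def)

lemma breakpoint_left: "breakpoint g q (- int j) = - (g * q ^ j)"
  by (simp add: breakpoint_def)

lemma cell_borel [simp]: "cell g q c i \<in> sets borel"
  by (simp add: cell_def)

lemma cell_bounded [simp]: "bounded (cell g q c i)"
  by (auto simp: cell_def intro: bounded_subset[OF bounded_closed_interval])

lemma cell_gap: "cell g q c 0 = {c - g ..< c + g}"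
  by (simp add: cell_def breakpoint_def)

lemma cell_right: "cell g q c (int j + 1) = {c + g * q ^ j ..< c + g * q ^ (j + 1)}"
  using breakpoint_right[of g q j] breakpoint_right[of g q "Suc j"] by (simp add: cell_def add.commute)

lemma cell_left: "cell g q c (- int j - 1) = {c - g * q ^ (j + 1) ..< c - g * q ^ j}"
  using breakpoint_left[of g q j] breakpoint_left[of g q "j + 1"]
  by (simp add: cell_def minus_diff_commute)

lemma int_trichotomy:
  obtains "i = 0" | j where "i = int j + 1" | j where "i = - int j - 1"
proof -
  consider "i = 0" | "i \<ge> 1" | "i \<le> -1" by linarith
  then show thesis
  proof cases
    case 2 then show ?thesis using that(2)[of "nat (i - 1)"] by simp
  next
    case 3 then show ?thesis using that(3)[of "nat (- i - 1)"] by simp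
  qed (use that in simp)
qed

context
  fixes g q :: real
  assumes g_pos: "0 < g" and q_gt_1: "1 < q"
begin

lemma breakpoint_less_succ: "breakpoint g q i < breakpoint g q (i + 1)"
proof (cases rule: int_trichotomy[of i])
  case 1
  then show ?thesis using g_pos by (simp add: breakpoint_def)
next
  case (2 j)
  have "g * q ^ j < g * q ^ Suc j"
    using g_pos q_gt_1 by (intro mult_strict_left_mono power_strict_increasing) auto
  then show ?thesis
    using breakpoint_right[of g q j] breakpoint_right[of g q "Suc j"] 2 by (simp add: add.commute)
next
  case (3 j)
  have "g * q ^ j < g * q ^ Suc j"
    using g_pos q_gt_1 by (intro mult_strict_left_mono power_strict_increasing) auto
  then show ?thesis
    using breakpoint_left[of g q j] breakpoint_left[of g q "j + 1"] 3 by (simp add: minus_diff_commute)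
qed

lemma breakpoint_mono: "i \<le> j \<Longrightarrow> breakpoint g q i \<le> breakpoint g q j"
proof (induction j rule: int_ge_induct)
  case (step j)
  then show ?case using breakpoint_less_succ[of j] by simp
qed simp

lemma cell_disjoint:
  assumes "i \<noteq> j" shows "cell g q c i \<inter> cell g q c j = {}"
proof -
  have "cell g q c i \<inter> cell g q c j = {}" if "i < j" for i j
    using breakpoint_mono[of "i + 1" j] that by (auto simp: cell_def)
  then show ?thesis using assms by (metis inf_commute linorder_neq_iff)
qed

lemma cell_cover: "\<exists>i. x \<in> cell g q c i"
proof -
  obtain n where n: "\<bar>x - c\<bar> / g < q ^ n"
    using real_arch_pow[OF q_gt_1] by blast
  then have "\<bar>x - c\<bar> < g * q ^ n"
    using g_pos by (simp add: field_simps)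
  then have lo: "c + breakpoint g q (- int n) \<le> x" and hi: "x < c + breakpoint g q (int n + 1)"
    unfolding breakpoint_left breakpoint_right by auto
  \<comment> \<open>Climb from a breakpoint at or below \<open>x\<close>: the first breakpoint above
    \<open>x\<close> is the right end of the cell of \<open>x\<close>.\<close>
  have "\<exists>i. x \<in> cell g q c i" if "x < c + breakpoint g q j" "- int n \<le> j" for j
    using that(2,1)
  proof (induction j rule: int_ge_induct)
    case base
    then show ?case using lo by simp
  next
    case (step j)
    show ?case
    proof (cases "x < c + breakpoint g q j")
      case False
      then have "x \<in> cell g q c j" using step.prems by (simp add: cell_def)
      then show ?thesis ..
    qed (use step in simp)
  qed
  from this[OF hi] show ?thesis by simp
qed

lemma measure_cell_outer:
  assumes "i \<noteq> 0"
  shows "measure lborel (cell g q c i) = g * (q - 1) * q ^ (nat \<bar>i\<bar> - 1)"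
proof -
  have mono: "g * q ^ j \<le> g * q ^ (j + 1)" for j
    using g_pos q_gt_1 by (intro mult_left_mono power_increasing) auto
  show ?thesis
  proof (cases rule: int_trichotomy[of i])
    case (2 j)
    then show ?thesis using mono[of j] by (simp only: cell_right) (simp add: nat_add_distrib algebra_simps)
  next
    case (3 j)
    then show ?thesis using mono[of j] by (simp only: cell_left) (simp add: nat_add_distrib algebra_simps)
  qed (use assms in simp)
qed

text \<open>
  A point of an outer cell has at least \<open>k\<close> neighbours within the cell, whose length is less than
  \<open>1 / \<alpha>\<close> times the distance from the cell to the centre \<open>c\<close>. So no ball reaches \<open>c\<close>.
\<close>

lemma gn_radius_less_dist_centre:
  assumes fin: "\<And>B. bounded B \<Longrightarrow> finite (V \<inter> B)"
    and \<alpha>: "0 \<le> \<alpha>" "\<alpha> * (q - 1) < 1"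
    and counts: "\<And>i. card (V \<inter> cell g q c i) \<in> cell_counts k i"
    and x: "x \<in> V"
  shows "gn_radius V k \<alpha> x < \<bar>x - c\<bar>"
proof -
  obtain i where i: "x \<in> cell g q c i"
    using cell_cover by blast
  have i0: "i \<noteq> 0"
  proof
    assume "i = 0"
    \<comment> \<open>Local finiteness enters because \<open>card\<close> is 0 on infinite sets
      too.\<close>
    then have "V \<inter> cell g q c i = {}"
      using counts[of i] fin[OF cell_bounded, of g q c i] by (simp add: cell_counts_def)
    then show False using i x by blast
  qed
  \<comment> \<open>The distance from \<open>c\<close> to the nearer end of the cell; the cell has
    length \<open>(q - 1) * u\<close>.\<close>
  define u where "u = g * q ^ (nat \<bar>i\<bar> - 1)"
  have u: "0 < u" using g_pos q_gt_1 by (simp add: u_def)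
  have far: "u \<le> \<bar>x - c\<bar>" and near: "\<And>y. y \<in> cell g q c i \<Longrightarrow> dist x y \<le> (q - 1) * u"
  proof -
    have "u \<le> \<bar>x - c\<bar> \<and> (\<forall>y\<in>cell g q c i. dist x y \<le> (q - 1) * u)"
    proof (cases rule: int_trichotomy[of i])
      case (2 j)
      then have "cell g q c i = {c + u ..< c + q * u}" "0 \<le> u"
        using cell_right[of g q c j] u by (simp_all add: u_def nat_add_distrib mult.left_commute)
      then show ?thesis using i by (auto simp: dist_real_def algebra_simps)
    next
      case (3 j)
      then have "cell g q c i = {c - q * u ..< c - u}" "0 \<le> u"
        using cell_left[of g q c j] u by (simp_all add: u_def nat_add_distrib mult.left_commute)
      then show ?thesis using i by (auto simp: dist_real_def algebra_simps)
    qed (use i0 in simp)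
    then show "u \<le> \<bar>x - c\<bar>" and "\<And>y. y \<in> cell g q c i \<Longrightarrow> dist x y \<le> (q - 1) * u" by auto
  qed
  have "nn_dist V k x \<le> (q - 1) * u"
  proof (rule nn_dist_le)
    have "Suc k \<le> card (V \<inter> cell g q c i)"
      using counts[of i] i0 by (simp add: cell_counts_def)
    then have "k \<le> card (V \<inter> cell g q c i - {x})"
      using i x by simp
    also have "\<dots> \<le> card {y \<in> V - {x}. dist x y \<le> (q - 1) * u}"
    proof (rule card_mono)
      have "{y \<in> V - {x}. dist x y \<le> (q - 1) * u} \<subseteq> V \<inter> cball x ((q - 1) * u)"
        by auto
      then show "finite {y \<in> V - {x}. dist x y \<le> (q - 1) * u}"
        by (rule finite_subset) (simp add: fin)
    qed (use near in auto)
    finally show "k \<le> card {y \<in> V - {x}. dist x y \<le> (q - 1) * u}" .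
  qed (use u q_gt_1 in simp)
  then have "gn_radius V k \<alpha> x \<le> (\<alpha> * (q - 1)) * u"
    unfolding gn_radius_def using mult_left_mono[OF _ \<alpha>(1)] by (simp add: mult.assoc)
  also have "\<dots> < 1 * u"
    using \<alpha>(2) u by (intro mult_strict_right_mono)
  finally show ?thesis using far by simp
qed

end

section \<open>Blocked points and finiteness of components\<close>

text \<open>A condition on each vertex separately that excludes edges across
  \<open>c\<close>.\<close>

definition blocked :: "real set \<Rightarrow> nat \<Rightarrow> real \<Rightarrow> real \<Rightarrow> bool" where
  "blocked V k \<alpha> c \<longleftrightarrow> (\<forall>x\<in>V. gn_radius V k \<alpha> x < \<bar>x - c\<bar>)"

text \<open>If \<open>c\<close> separates \<open>x\<close> from \<open>y\<close>, then
  \<open>\<bar>x - y\<bar>\<close> is at least the distance of either one to \<open>c\<close>, which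
  exceeds its radius.\<close>

lemma blocked_edge:
  assumes "blocked V k \<alpha> c" "(x, y) \<in> gn_edges V k \<alpha>"
  shows "x < c \<longleftrightarrow> y < c"
proof -
  have "x \<in> V" "y \<in> V" "\<bar>x - y\<bar> \<le> gn_radius V k \<alpha> x \<or> \<bar>x - y\<bar> \<le> gn_radius V k \<alpha> y"
    using assms(2) by (auto simp: gn_edges_def dist_real_def)
  moreover from this have "gn_radius V k \<alpha> x < \<bar>x - c\<bar>" "gn_radius V k \<alpha> y < \<bar>y - c\<bar>"
    using assms(1) by (auto simp: blocked_def)
  ultimately show ?thesis by linarith
qed

lemma blocked_connected:
  assumes "blocked V k \<alpha> c" "(x, y) \<in> (gn_edges V k \<alpha>)\<^sup>*"
  shows "x < c \<longleftrightarrow> y < c"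
  using assms(2) by induction (use blocked_edge[OF assms(1)] in auto)

text \<open>The component of \<open>x\<close> is trapped between a blocked point on each side, hence
  lies in a bounded interval.\<close>

lemma no_infinite_component:
  assumes fin: "\<And>B. bounded B \<Longrightarrow> finite (V \<inter> B)"
    and right: "\<And>x. \<exists>c>x. blocked V k \<alpha> c"
    and left: "\<And>x. \<exists>c<x. blocked V k \<alpha> c"
  shows "\<not> has_infinite_component V (gn_edges V k \<alpha>)"
  unfolding has_infinite_component_def
proof safe
  fix x assume "infinite {y \<in> V. (x, y) \<in> (gn_edges V k \<alpha>)\<^sup>*}"
  moreover obtain c d where cd: "c < x" "blocked V k \<alpha> c" "x < d" "blocked V k \<alpha> d"
    using left right by meson
  have "{y \<in> V. (x, y) \<in> (gn_edges V k \<alpha>)\<^sup>*} \<subseteq> V \<inter> {c..d}"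
    using blocked_connected[OF cd(2)] blocked_connected[OF cd(4)] cd(1,3) by fastforce
  ultimately show False
    using finite_subset[OF _ fin[of "{c..d}"]] by simp
qed

section \<open>Geometric sums and disjoint windows\<close>

lemma sum_int_symmetric_interval:
  fixes h :: "nat \<Rightarrow> real"
  shows "(\<Sum>i\<in>{- int m..int m} - {0}. h (nat \<bar>i\<bar> - 1)) = 2 * (\<Sum>j<m. h j)"
proof (induction m)
  case (Suc m)
  have "{- int (Suc m)..int (Suc m)} - {0} =
      insert (int m + 1) (insert (- int m - 1) ({- int m..int m} - {0}))"
    by auto
  then show ?case using Suc by (simp add: nat_add_distrib)
qed simp

lemma sum_geometric_le:
  fixes q :: real
  assumes "1 < q"
  shows "(\<Sum>j<m. (1 / q) ^ j) \<le> q / (q - 1)"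
proof -
  have "(\<Sum>j<m. (1 / q) ^ j) \<le> (\<Sum>j. (1 / q) ^ j)"
    using assms by (intro sum_le_suminf summable_geometric) auto
  also have "\<dots> = q / (q - 1)"
    using assms by (subst suminf_geometric) (auto simp: field_simps)
  finally show ?thesis .
qed

text \<open>Window \<open>m\<close> reaches \<open>g * q ^ m\<close> to either side of its centre.
  The factor \<open>(q + 1) / (q - 1)\<close> makes consecutive centres
  \<open>g * q ^ m + g * q ^ (m + 1)\<close> apart, so that their windows just abut. The sign
  \<open>s\<close> selects the direction.\<close>

definition centre :: "real \<Rightarrow> real \<Rightarrow> real \<Rightarrow> nat \<Rightarrow> real" where
  "centre g q s m = s * (g * ((q + 1) / (q - 1)) * q ^ m)"

lemma windows_disjoint:
  assumes g: "0 < g" and q: "1 < q" and s: "\<bar>s\<bar> = 1"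
    and i: "i \<in> {- int m..int m}" and j: "j \<in> {- int n..int n}" and ne: "(m, i) \<noteq> (n, j)"
  shows "cell g q (centre g q s m) i \<inter> cell g q (centre g q s n) j = {}"
proof -
  have sub: "cell g q (centre g q s m) i \<subseteq> {centre g q s m - g * q ^ m ..< centre g q s m + g * q ^ m}"
    if "i \<in> {- int m..int m}" for m i
    using breakpoint_mono[OF g q, of "- int m" i] breakpoint_mono[OF g q, of "i + 1" "int m + 1"] that
    unfolding cell_def breakpoint_left breakpoint_right by auto
  have sep: "cell g q (centre g q s m) i \<inter> cell g q (centre g q s n) j = {}"
    if mn: "m < n" and i: "i \<in> {- int m..int m}" and j: "j \<in> {- int n..int n}" for m n i j
  proof -
    define u where "u = g * q ^ m"
    define v where "v = g * q ^ n"
    define D where "D = (q + 1) / (q - 1)"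
    have u: "0 < u" using g q by (simp add: u_def)
    \<comment> \<open>Since \<open>m < n\<close>, \<open>q * u \<le> v\<close>. Scaled by
      \<open>2 / (q - 1)\<close>, this says that the centres are at least \<open>u + v\<close>
      apart, the sum of the two window radii.\<close>
    have "g * q ^ Suc m \<le> g * q ^ n"
      using g q mn by (intro mult_left_mono power_increasing) auto
    then have "2 / (q - 1) * (q * u) \<le> 2 / (q - 1) * v"
      using q by (intro mult_left_mono) (auto simp: u_def v_def mult.left_commute)
    moreover have "D - 1 = 2 / (q - 1)" "D + 1 = 2 / (q - 1) * q"
      using q by (simp_all add: D_def field_simps)
    ultimately have "(D + 1) * u \<le> (D - 1) * v"
      by (simp add: mult.assoc)
    then have gap: "u + v \<le> D * v - D * u"
      by (simp add: algebra_simps)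
    have c: "centre g q s m = s * (D * u)" "centre g q s n = s * (D * v)"
      by (simp_all add: centre_def D_def u_def v_def)
    consider "s = 1" | "s = -1" using s by linarith
    then show ?thesis
      using sub[OF i] sub[OF j] gap unfolding c u_def[symmetric] v_def[symmetric]
      by cases (fastforce simp: disjoint_iff)+
  qed
  consider "m < n" | "n < m" | "m = n" by linarith
  then show ?thesis
  proof cases
    case 1 then show ?thesis using sep i j by blast
  next
    case 2 then show ?thesis using sep[of n m j i] i j by blast
  next
    case 3 then show ?thesis using ne cell_disjoint[OF g q] by simp
  qed
qed

section \<open>Almost sure existence of blocked centres\<close>

context homogeneous_poisson_process
begin

lemma prob_count_complement:
  assumes "B \<in> sets borel" "bounded B"
  shows "prob {\<omega> \<in> space M. card (X \<omega> \<inter> B) \<in> S} = 1 - prob {\<omega> \<in> space M. card (X \<omega> \<inter> B) \<notin> S}"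
  using prob_neg[OF event_card_in[OF assms, of S]] by simp

end

text \<open>\<open>\<delta>\<close> bounds the probability that a given cell next to the gap is bad.
  By \<open>\<delta>_small\<close> the bounds \<open>\<delta> * (1 / q) ^ j\<close>, summed over the
  outer cells of both sides, give at most 1/2.\<close>

locale poisson_line = homogeneous_poisson_process M X \<rho>
  for M :: "'w measure" and X :: "'w \<Rightarrow> real set" and \<rho> :: real +
  fixes k :: nat and g q s \<delta> :: real
  assumes g_pos: "0 < g" and q_gt_1: "1 < q" and s_abs: "\<bar>s\<bar> = 1"
    and \<delta>: "\<delta> = (real k + 1)\<^sup>2 / (\<rho> * (g * (q - 1)))"
    and \<delta>_small: "4 * \<delta> * (q / (q - 1)) \<le> 1"
begin

abbreviation N :: "nat \<Rightarrow> int \<Rightarrow> 'w \<Rightarrow> nat" where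
  "N m i \<omega> \<equiv> card (X \<omega> \<inter> cell g q (centre g q s m) i)"

lemma \<delta>_pos: "0 < \<delta>"
  using g_pos q_gt_1 intensity_pos by (simp add: \<delta>)

lemma event_N: "{\<omega> \<in> space M. N m i \<omega> \<in> S} \<in> events"
  by (rule event_card_in) auto

lemma prob_bad_cell:
  assumes "i \<noteq> 0"
  shows "prob {\<omega> \<in> space M. N m i \<omega> \<notin> cell_counts k i} \<le> \<delta> * (1 / q) ^ (nat \<bar>i\<bar> - 1)"
proof -
  let ?C = "cell g q (centre g q s m) i" and ?u = "q ^ (nat \<bar>i\<bar> - 1)"
  have measure: "measure lborel ?C = g * (q - 1) * ?u"
    by (rule measure_cell_outer[OF g_pos q_gt_1 assms])
  then have "0 < measure lborel ?C" using g_pos q_gt_1 by simp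
  from prob_count_le[OF cell_borel cell_bounded this, of k]
  have "prob {\<omega> \<in> space M. N m i \<omega> \<le> k} \<le> (real k + 1)\<^sup>2 / (\<rho> * (g * (q - 1) * ?u))"
    unfolding measure .
  also have "\<dots> = \<delta> * (1 / q) ^ (nat \<bar>i\<bar> - 1)"
    by (simp add: \<delta> power_one_over)
  finally show ?thesis
    using assms by (simp add: cell_counts_def not_less)
qed

lemma prob_gap: "prob {\<omega> \<in> space M. N m 0 \<omega> \<in> cell_counts k 0} = exp (- (\<rho> * (2 * g)))"
proof -
  have "measure lborel (cell g q (centre g q s m) 0) = 2 * g"
    using g_pos by (simp add: cell_gap)
  then show ?thesis
    using count_distribution[OF cell_borel cell_bounded, of g q "centre g q s m" 0 0]
    by (simp add: cell_counts_def)
qed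

text \<open>The bound must not depend on \<open>m\<close>. The empty gap contributes the
  exponential, and the outer cells together at least 1/2.\<close>

lemma prob_window:
  "exp (- (\<rho> * (2 * g))) / 2 \<le>
    (\<Prod>i\<in>{- int m..int m}. prob {\<omega> \<in> space M. N m i \<omega> \<in> cell_counts k i})"
proof -
  let ?I = "{- int m..int m} - {0}"
  let ?bad = "\<lambda>i. prob {\<omega> \<in> space M. N m i \<omega> \<notin> cell_counts k i}"
  have "(\<Sum>i\<in>?I. ?bad i) \<le> (\<Sum>i\<in>?I. \<delta> * (1 / q) ^ (nat \<bar>i\<bar> - 1))"
    by (intro sum_mono prob_bad_cell) auto
  also have "\<dots> = 2 * \<delta> * (\<Sum>j<m. (1 / q) ^ j)"
    by (subst sum_int_symmetric_interval) (simp add: sum_distrib_left mult.assoc)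
  also have "\<dots> \<le> 2 * \<delta> * (q / (q - 1))"
    using \<delta>_pos by (intro mult_left_mono sum_geometric_le q_gt_1) auto
  also have "\<dots> \<le> 1 / 2" using \<delta>_small by simp
  finally have "1 / 2 \<le> 1 - (\<Sum>i\<in>?I. ?bad i)" by simp
  \<comment> \<open>The Weierstrass inequality turns the bound on the sum into one on the
    product.\<close>
  also have "\<dots> \<le> (\<Prod>i\<in>?I. 1 - ?bad i)"
    by (intro Weierstrass_prod_ineq) simp
  finally have "exp (- (\<rho> * (2 * g))) * (1 / 2) \<le> exp (- (\<rho> * (2 * g))) * (\<Prod>i\<in>?I. 1 - ?bad i)"
    by (intro mult_left_mono) auto
  also have "(\<Prod>i\<in>?I. 1 - ?bad i) = (\<Prod>i\<in>?I. prob {\<omega> \<in> space M. N m i \<omega> \<in> cell_counts k i})"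
    by (intro prod.cong refl prob_count_complement[symmetric]) auto
  finally show ?thesis
    by (subst prod.remove[of _ 0]) (auto simp: prob_gap)
qed

text \<open>The second Borel--Cantelli argument carried out directly: disjoint windows are
  independent, so \<open>l + 1\<close> consecutive ones all fail with probability at most
  \<open>(1 - p) ^ Suc l\<close>.\<close>

lemma AE_good_windows:
  "AE \<omega> in M. \<forall>n. \<exists>m\<ge>n. \<forall>i\<in>{- int m..int m}. N m i \<omega> \<in> cell_counts k i"
proof -
  define p where "p = exp (- (\<rho> * (2 * g))) / 2"
  have p: "0 < p" "p < 1"
  proof -
    have "exp (- (\<rho> * (2 * g))) \<le> 1"
      using g_pos intensity_pos by simp
    then have "exp (- (\<rho> * (2 * g))) < 2" by linarith
    then show "0 < p" "p < 1" by (simp_all add: p_def)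
  qed
  let ?K = "\<lambda>m. {- int m..int m}"
  let ?good = "\<lambda>m \<omega>. \<forall>i\<in>?K m. N m i \<omega> \<in> cell_counts k i"
  have event_good: "{\<omega> \<in> space M. ?good m \<omega>} \<in> events" for m
    by (intro sets.sets_Collect_finite_All event_N) simp
  have event_bad: "{\<omega> \<in> space M. \<forall>m\<in>L. \<not> ?good m \<omega>} \<in> events" for L
    by (intro sets.sets_Collect_countable_Ball sets.sets_Collect_neg event_good countableI_type)
  have bound: "prob {\<omega> \<in> space M. \<forall>m\<in>{n..n + l}. \<not> ?good m \<omega>} \<le> (1 - p) ^ Suc l" for n l
  proof -
    let ?L = "{n..n + l}"
    let ?C = "\<lambda>a. cell g q (centre g q s (fst a)) (snd a)"
    let ?Y = "\<lambda>a \<omega>. card (X \<omega> \<inter> ?C a)" and ?S = "\<lambda>a :: nat \<times> int. cell_counts k (snd a)"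
    let ?P = "\<lambda>m. Pair m ` ?K m"
    have ind: "indep_vars (\<lambda>_. count_space UNIV) ?Y (Sigma ?L ?K)"
    proof (rule count_indep_finite)
      show "disjoint_family_on ?C (Sigma ?L ?K)"
        unfolding disjoint_family_on_def
      proof (intro ballI impI)
        fix a b assume "a \<in> Sigma ?L ?K" "b \<in> Sigma ?L ?K" "a \<noteq> b"
        then show "?C a \<inter> ?C b = {}"
          by (intro windows_disjoint[OF g_pos q_gt_1 s_abs]) auto
      qed
    qed auto
    have "{\<omega> \<in> space M. \<forall>m\<in>?L. \<not> ?good m \<omega>} =
        {\<omega> \<in> space M. \<forall>m\<in>?L. \<exists>a\<in>?P m. ?Y a \<omega> \<notin> ?S a}"
      by auto
    also have "prob \<dots> = (\<Prod>m\<in>?L. 1 - (\<Prod>a\<in>?P m. prob {\<omega> \<in> space M. ?Y a \<omega> \<in> ?S a}))"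
      by (rule prob_all_blocks_fail[OF ind]) (auto simp: disjoint_family_on_def)
    also have "\<dots> = (\<Prod>m\<in>?L. 1 - (\<Prod>i\<in>?K m. prob {\<omega> \<in> space M. N m i \<omega> \<in> cell_counts k i}))"
      by (simp add: prod.reindex inj_on_def)
    also have "\<dots> \<le> (\<Prod>m\<in>?L. 1 - p)"
      using prob_window by (intro prod_mono) (auto simp: p_def intro!: prod_le_1)
    also have "\<dots> = (1 - p) ^ Suc l" by simp
    finally show ?thesis .
  qed
  \<comment> \<open>Failing for ever from \<open>n\<close> on entails failing on every finite
    stretch, so the bound holds for all \<open>l\<close>.\<close>
  have "prob {\<omega> \<in> space M. \<forall>m\<in>{n..}. \<not> ?good m \<omega>} = 0" for n
  proof -
    have "prob {\<omega> \<in> space M. \<forall>m\<in>{n..}. \<not> ?good m \<omega>} \<le> (1 - p) ^ Suc l" for l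
      by (rule order_trans[OF finite_measure_mono[OF _ event_bad] bound[of n l]]) auto
    moreover have "(\<lambda>l. (1 - p) ^ Suc l) \<longlonglongrightarrow> 0"
      using p by (intro LIMSEQ_Suc LIMSEQ_power_zero) auto
    ultimately have "prob {\<omega> \<in> space M. \<forall>m\<in>{n..}. \<not> ?good m \<omega>} \<le> 0"
      by (intro LIMSEQ_le_const) auto
    then show ?thesis by (simp add: measure_le_0_iff)
  qed
  then have "AE \<omega> in M. \<not> (\<forall>m\<in>{n..}. \<not> ?good m \<omega>)" for n
    by (subst AE_iff_measurable[OF event_bad[of "{n..}"]]) (auto simp: emeasure_eq_measure)
  then have "AE \<omega> in M. \<forall>n. \<not> (\<forall>m\<in>{n..}. \<not> ?good m \<omega>)"
    by (simp add: AE_all_countable)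
  then show ?thesis by eventually_elim fastforce
qed

text \<open>First Borel--Cantelli lemma: by the geometric cell bounds, a bad cell beyond window
  \<open>m\<close> has probability at most a constant times \<open>(1 / q) ^ m\<close>, which is
  summable in \<open>m\<close>.\<close>

lemma AE_good_tails:
  "AE \<omega> in M. \<forall>\<^sub>F m in sequentially. \<forall>i. i \<notin> {- int m..int m} \<longrightarrow> N m i \<omega> \<in> cell_counts k i"
proof -
  let ?bad = "\<lambda>m i. {\<omega> \<in> space M. N m i \<omega> \<notin> cell_counts k i}"
  \<comment> \<open>\<open>j\<close> counts, from 0, the cells beyond window \<open>m\<close>; the
    two mirror images are taken together.\<close>
  let ?D = "\<lambda>m j. ?bad m (int (m + j) + 1) \<union> ?bad m (- int (m + j) - 1)"
  let ?T = "\<lambda>m. \<Union>j. ?D m j"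
  let ?a = "\<lambda>m j. 2 * \<delta> * (1 / q) ^ m * (1 / q) ^ j"
  have event_bad: "?bad m i \<in> events" for m i
    using event_N[of m i "- cell_counts k i"] by simp
  have event_D: "?D m j \<in> events" for m j
    by (intro sets.Un event_bad)
  have event_T: "?T m \<in> events" for m
    using event_D by (intro sets.countable_UN) blast
  have D: "prob (?D m j) \<le> ?a m j" for m j
  proof -
    have "prob (?D m j) \<le> prob (?bad m (int (m + j) + 1)) + prob (?bad m (- int (m + j) - 1))"
      by (intro measure_Un_le event_bad)
    also have "\<dots> \<le> \<delta> * (1 / q) ^ (m + j) + \<delta> * (1 / q) ^ (m + j)"
    proof -
      have "nat \<bar>int (m + j) + 1\<bar> - 1 = m + j" "nat \<bar>- int (m + j) - 1\<bar> - 1 = m + j"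
        by linarith+
      then show ?thesis
        using prob_bad_cell[of "int (m + j) + 1" m] prob_bad_cell[of "- int (m + j) - 1" m]
        by simp
    qed
    also have "\<dots> = ?a m j" by (simp add: power_add)
    finally show ?thesis .
  qed
  have geom: "(\<lambda>j. (1 / q) ^ j) sums (1 / (1 - 1 / q))"
    using q_gt_1 by (intro geometric_sums) simp
  have sums: "?a m sums (2 * \<delta> * (1 / q) ^ m * (1 / (1 - 1 / q)))" for m
    by (intro sums_mult geom)
  have T: "prob (?T m) \<le> 2 * \<delta> * (1 / (1 - 1 / q)) * (1 / q) ^ m" for m
  proof -
    have summable: "summable (\<lambda>j. prob (?D m j))"
      by (rule summable_comparison_test'[OF sums_summable[OF sums]]) (use D in auto)
    have "prob (?T m) \<le> (\<Sum>j. prob (?D m j))"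
      by (intro finite_measure_subadditive_countably summable) (use event_D in auto)
    also have "\<dots> \<le> (\<Sum>j. ?a m j)"
      by (intro suminf_le D summable sums_summable[OF sums])
    finally show ?thesis using sums_unique[OF sums] by (simp add: mult_ac)
  qed
  have "summable (\<lambda>m. prob (?T m))"
  proof (rule summable_comparison_test')
    show "summable (\<lambda>m. 2 * \<delta> * (1 / (1 - 1 / q)) * (1 / q) ^ m)"
      by (intro summable_mult sums_summable[OF geom])
  qed (use T in auto)
  then have "AE \<omega> in M. \<forall>\<^sub>F m in sequentially. \<omega> \<in> space M - ?T m"
    by (intro borel_cantelli_AE1 event_T) (auto simp: emeasure_eq_measure)
  then show ?thesis
  proof eventually_elim
    case (elim \<omega>)
    then show ?case
    proof eventually_elim
      case (elim m)
      show ?case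
      proof (intro allI impI)
        fix i assume "i \<notin> {- int m..int m}"
        then consider "i = int (m + nat (i - int m - 1)) + 1" | "i = - int (m + nat (- i - int m - 1)) - 1"
          by fastforce
        then obtain j where "i = int (m + j) + 1 \<or> i = - int (m + j) - 1" by blast
        then show "N m i \<omega> \<in> cell_counts k i" using elim by blast
      qed
    qed
  qed
qed

text \<open>Good windows occur infinitely often and good tails eventually, so arbitrarily late
  \<open>m\<close> have both. The witness \<open>d\<close> is the distance of such a centre from 0,
  which exceeds \<open>x\<close> for large \<open>m\<close>.\<close>

lemma AE_blocked:
  assumes "0 \<le> \<alpha>" "\<alpha> * (q - 1) < 1"
  shows "AE \<omega> in M. \<forall>x. \<exists>d>x. blocked (X \<omega>) k \<alpha> (s * d)"
  using AE_good_windows AE_good_tails AE_space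
proof eventually_elim
  case (elim \<omega>)
  show ?case
  proof
    fix x
    let ?D = "g * ((q + 1) / (q - 1))"
    have D: "0 < ?D" using g_pos q_gt_1 by simp
    obtain n where n: "\<bar>x\<bar> / ?D < q ^ n"
      using real_arch_pow[OF q_gt_1] by blast
    obtain n' where n': "\<And>m i. \<lbrakk>n' \<le> m; i \<notin> {- int m..int m}\<rbrakk> \<Longrightarrow> N m i \<omega> \<in> cell_counts k i"
      using elim(2) unfolding eventually_sequentially by blast
    obtain m where m: "max n n' \<le> m" "\<forall>i\<in>{- int m..int m}. N m i \<omega> \<in> cell_counts k i"
      using elim(1) by blast
    have "blocked (X \<omega>) k \<alpha> (centre g q s m)"
      unfolding blocked_def
    proof
      fix y assume y: "y \<in> X \<omega>"
      show "gn_radius (X \<omega>) k \<alpha> y < \<bar>y - centre g q s m\<bar>"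
      proof (rule gn_radius_less_dist_centre[OF g_pos q_gt_1 _ assms _ y])
        show "N m i \<omega> \<in> cell_counts k i" for i
          using m n'[of m i] by auto
      qed (rule locally_finite[OF elim(3)])
    qed
    moreover have "q ^ n \<le> q ^ m"
      using q_gt_1 m(1) by (intro power_increasing) auto
    with n have "\<bar>x\<bar> / ?D < q ^ m" by linarith
    then have "x < ?D * q ^ m"
      unfolding pos_divide_less_eq[OF D] mult.commute[of _ ?D] by linarith
    ultimately show "\<exists>d>x. blocked (X \<omega>) k \<alpha> (s * d)"
      unfolding centre_def by blast
  qed
qed

end

section \<open>Choice of constants and conclusion\<close>

lemma AE_blocked_direction:
  fixes M :: "'w measure" and X :: "'w \<Rightarrow> real set" and \<rho> \<alpha> s :: real and k :: nat
  assumes "homogeneous_poisson_process M X \<rho>" and \<alpha>: "0 \<le> \<alpha>" and s: "\<bar>s\<bar> = 1"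
  shows "AE \<omega> in M. \<forall>x. \<exists>d>x. blocked (X \<omega>) k \<alpha> (s * d)"
proof -
  interpret homogeneous_poisson_process M X \<rho> by fact
  \<comment> \<open>This makes \<open>\<alpha> * (q - 1) = \<alpha> / (\<alpha> + 1)\<close>, which
    is below 1.\<close>
  define q where "q = 1 + 1 / (\<alpha> + 1)"
  \<comment> \<open>Chosen so that \<open>\<delta>_small\<close> holds with equality.\<close>
  define g where "g = 4 * (real k + 1)\<^sup>2 * q / (\<rho> * (q - 1)\<^sup>2)"
  have q: "1 < q" and \<alpha>q: "\<alpha> * (q - 1) < 1"
    using \<alpha> by (auto simp: q_def field_simps)
  have g: "0 < g"
    using q intensity_pos by (simp add: g_def)
  interpret poisson_line M X \<rho> k g q s "(real k + 1)\<^sup>2 / (\<rho> * (g * (q - 1)))"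
  proof unfold_locales
    have "4 * ((real k + 1)\<^sup>2 / (\<rho> * (g * (q - 1)))) * (q / (q - 1)) =
        (4 * (real k + 1)\<^sup>2 * q / (\<rho> * (q - 1)\<^sup>2)) / g"
      using q g intensity_pos by (simp add: power2_eq_square)
    then show "4 * ((real k + 1)\<^sup>2 / (\<rho> * (g * (q - 1)))) * (q / (q - 1)) \<le> 1"
      using g unfolding g_def[symmetric] by simp
  qed (use q g s in auto)
  show ?thesis by (rule AE_blocked[OF \<alpha> \<alpha>q])
qed

lemma outer_measure_percolation_eq_0:
  fixes M :: "'w measure" and X :: "'w \<Rightarrow> real set" and \<rho> \<alpha> :: real and k :: nat
  assumes poisson: "homogeneous_poisson_process M X \<rho>" and \<alpha>: "0 \<le> \<alpha>"
  shows "outer_measure_of M (gn_percolation_event M X k \<alpha>) = 0"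
proof -
  interpret homogeneous_poisson_process M X \<rho> by fact
  have "AE \<omega> in M. \<not> has_infinite_component (X \<omega>) (gn_edges (X \<omega>) k \<alpha>)"
    using AE_blocked_direction[OF poisson \<alpha> abs_one, of k]
      AE_blocked_direction[OF poisson \<alpha> abs_neg_one, of k] AE_space
  proof eventually_elim
    case (elim \<omega>)
    show ?case
    proof (rule no_infinite_component)
      show "\<exists>c>x. blocked (X \<omega>) k \<alpha> c" for x
        using elim(1) by simp
      show "\<exists>c<x. blocked (X \<omega>) k \<alpha> c" for x
      proof -
        obtain d where "- x < d" "blocked (X \<omega>) k \<alpha> (- d)"
          using elim(2) by auto
        then show ?thesis by (intro exI[of _ "- d"]) simp
      qed
    qed (rule locally_finite[OF elim(3)])
  qed
  \<comment> \<open>The percolation event is not known to be measurable, so its outer measure is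
    bounded through a null set covering it.\<close>
  then obtain E where E: "E \<in> null_sets M" "gn_percolation_event M X k \<alpha> \<subseteq> E"
    unfolding eventually_ae_filter gn_percolation_event_def by auto
  have "outer_measure_of M (gn_percolation_event M X k \<alpha>) \<le> emeasure M E"
    unfolding outer_measure_of_def using E by (intro INF_lower) auto
  then show ?thesis using E by (simp add: null_sets_def)
qed

theorem theorem3p2:
  fixes M :: "'w measure" and X :: "'w \<Rightarrow> real set" and \<rho> :: real and k :: nat
  assumes "homogeneous_poisson_process M X \<rho>"
    and "k \<ge> 1"
  shows "gn_critical_value M X k = \<infinity>"
proof -
  have "{\<alpha>. 0 \<le> \<alpha> \<and> 0 < outer_measure_of M (gn_percolation_event M X k \<alpha>)} = {}"
    using outer_measure_percolation_eq_0[OF assms(1)] by auto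
  then show ?thesis
    unfolding gn_critical_value_def by (simp only: image_empty Inf_empty top_ereal_def)
qed

end
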